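(* A displacement field $\mathbf{u}:\Omega\to\mathbb{R}^3$ is universal for the trigonal class $\mathbb{Z}_3\oplus\mathbb{Z}_2^c$ of linear strain-gradient elastic solids if and only if it is the superposition (sum) of a homogeneous displacement field and a field $\mathbf{u}^{\mathrm{inh}}$ of the form $$u_1^{\mathrm{inh}}=a_{123}x_1x_2x_3+a_{12}x_1x_2+a_{13}x_1x_3+a_{23}x_2x_3,$$ $$u_2^{\mathrm{inh}}=\tfrac12(a_{12}+a_{123}x_3)(x_1^2-x_2^2)+b_{13}x_1x_3-a_{13}x_2x_3,$$ $$u_3^{\mathrm{inh}}=-a_{123}x_1^2x_2-(a_{23}+b_{13})x_1x_2+\tfrac13a_{123}x_2^3-a_{13}(x_1^2-x_2^2),$$ for some constants $a_{123},a_{12},a_{13},a_{23},b_{13}\in\mathbb{R}$.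
   Context: $\Omega\subset\mathbb{R}^3$ is a nonempty convex open set with Cartesian coordinates $(x_1,x_2,x_3)$ and orthonormal basis $e_1,e_2,e_3$. Repeated indices are summed over $1,2,3$ and a comma denotes partial differentiation. A displacement field is a smooth map $\mathbf{u}:\Omega\to\mathbb{R}^3$, with strain $e_{lm}=\tfrac12(u_{l,m}+u_{m,l})$. It is homogeneous if $\mathbf{u}(\mathbf{x})=\mathbf{H}\mathbf{x}+\mathbf{b}$ for a constant matrix $\mathbf{H}$ and constant vector $\mathbf{b}$. A strain-gradient material is a triple $(\mathsf{C},\mathsf{M},\mathsf{A})$ of constant real tensors of orders $4,5,6$ with index symmetries $\mathsf{C}_{ijlm}=\mathsf{C}_{jilm}=\mathsf{C}_{lmij}$, $\mathsf{M}_{ijklm}=\mathsf{M}_{jiklm}=\mathsf{M}_{ijlkm}$, $\mathsf{A}_{ijklmn}=\mathsf{A}_{jiklmn}=\mathsf{A}_{lmnijk}$. Its stress and hyper-stress are $\sigma_{ij}=\mathsf{C}_{ijlm}e_{lm}+\mathsf{M}_{ijlmn}e_{lm,n}$ and $\tau_{ijk}=\mathsf{M}_{lmijk}e_{lm}+\mathsf{A}_{ijklmn}e_{lm,n}$, and the equilibrium equations without body forces are $\sigma_{ij,j}-\tau_{ijk,jk}=0$ in $\Omega$ for $i=1,2,3$. For a subgroup $G\subset \mathrm{O}(3)$, a tensor $T$ of order $p$ is $G$-invariant if $Q_{i_1j_1}\cdots Q_{i_pj_p}T_{j_1\dots j_p}=T_{i_1\dots i_p}$ for all $Q\in G$. $\mathbb{Z}_3$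 is generated by the rotation by $2\pi/3$ about $e_3$; $\mathbb{D}_3$ is generated by $\mathbb{Z}_3$ and the rotation by $\pi$ about $e_2$; $\mathbb{Z}_2^c=\{I,-I\}$, and $G\oplus\mathbb{Z}_2^c$ is the group generated by $G$ and $-I$. The trigonal class $\mathbb{Z}_3\oplus\mathbb{Z}_2^c$ is the set of all materials with $\mathsf{C}$ $\mathbb{D}_3\oplus\mathbb{Z}_2^c$-invariant (6 independent constants), $\mathsf{M}=0$, and $\mathsf{A}$ $\mathbb{Z}_3\oplus\mathbb{Z}_2^c$-invariant (57 independent constants). A displacement field is universal for the class if it satisfies the equilibrium equations for every material in the class. *)

theory Defs
  imports "HOL-Analysis.Analysis" "HOL-Algebra.Generated_Groups"
begin

text \<open>
  Fields are total functions on \<open>real^3\<close>, but only their values on the open set \<open>\<Omega>\<close> matter: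
  derivatives at a point of \<open>\<Omega>\<close> depend only on values nearby. The partial derivative is the
  Frechet derivative applied to a basis vector, so it is meaningful only for functions that
  are differentiable at the point, as smooth ones are.
\<close>

definition partial_deriv :: "3 \<Rightarrow> (real^3 \<Rightarrow> real) \<Rightarrow> (real^3 \<Rightarrow> real)" where
  "partial_deriv k f x = frechet_derivative f (at x) (axis k 1)"

text \<open>
  On an open set this is \<open>C\<^sup>\<infinity>\<close>: iterated partial derivatives of all orders exist and are
  differentiable, hence continuous.
\<close>

definition smooth_on :: "(real^3) set \<Rightarrow> (real^3 \<Rightarrow> real) \<Rightarrow> bool" where
  "smooth_on \<Omega> f \<longleftrightarrow> (\<forall>ks. foldr partial_deriv ks f differentiable_on \<Omega>)"

definition displacement_field :: "(real^3) set \<Rightarrow> (real^3 \<Rightarrow> real^3) \<Rightarrow> bool" where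
  "displacement_field \<Omega> u \<longleftrightarrow> (\<forall>i. smooth_on \<Omega> (\<lambda>x. u x $ i))"

definition homogeneous :: "(real^3) set \<Rightarrow> (real^3 \<Rightarrow> real^3) \<Rightarrow> bool" where
  "homogeneous \<Omega> u \<longleftrightarrow> (\<exists>(H :: real^3^3) (b :: real^3). \<forall>x\<in>\<Omega>. u x = H *v x + b)"

definition strain :: "(real^3 \<Rightarrow> real^3) \<Rightarrow> 3 \<Rightarrow> 3 \<Rightarrow> real^3 \<Rightarrow> real" where
  "strain u l m x =
     (partial_deriv m (\<lambda>y. u y $ l) x + partial_deriv l (\<lambda>y. u y $ m) x) / 2"

type_synonym tensor4 = "3 \<Rightarrow> 3 \<Rightarrow> 3 \<Rightarrow> 3 \<Rightarrow> real"
type_synonym tensor5 = "3 \<Rightarrow> 3 \<Rightarrow> 3 \<Rightarrow> 3 \<Rightarrow> 3 \<Rightarrow> real"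
type_synonym tensor6 = "3 \<Rightarrow> 3 \<Rightarrow> 3 \<Rightarrow> 3 \<Rightarrow> 3 \<Rightarrow> 3 \<Rightarrow> real"

type_synonym elastic_moduli = "tensor4 \<times> tensor5 \<times> tensor6"

definition strain_gradient_materials :: "elastic_moduli set" where
  "strain_gradient_materials = {(C, M, A).
     (\<forall>i j l m. C i j l m = C j i l m \<and> C i j l m = C l m i j) \<and>
     (\<forall>i j k l m. M i j k l m = M j i k l m \<and> M i j k l m = M i j l k m) \<and>
     (\<forall>i j k l m n. A i j k l m n = A j i k l m n \<and> A i j k l m n = A l m n i j k)}"

definition stress ::
  "elastic_moduli \<Rightarrow> (real^3 \<Rightarrow> real^3) \<Rightarrow> 3 \<Rightarrow> 3 \<Rightarrow> real^3 \<Rightarrow> real" where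
  "stress = (\<lambda>(C, M, A) u i j x.
     (\<Sum>l\<in>UNIV. \<Sum>m\<in>UNIV. C i j l m * strain u l m x) +
     (\<Sum>l\<in>UNIV. \<Sum>m\<in>UNIV. \<Sum>n\<in>UNIV. M i j l m n * partial_deriv n (strain u l m) x))"

definition hyper_stress ::
  "elastic_moduli \<Rightarrow> (real^3 \<Rightarrow> real^3) \<Rightarrow> 3 \<Rightarrow> 3 \<Rightarrow> 3 \<Rightarrow> real^3 \<Rightarrow> real" where
  "hyper_stress = (\<lambda>(C, M, A) u i j k x.
     (\<Sum>l\<in>UNIV. \<Sum>m\<in>UNIV. M l m i j k * strain u l m x) +
     (\<Sum>l\<in>UNIV. \<Sum>m\<in>UNIV. \<Sum>n\<in>UNIV. A i j k l m n * partial_deriv n (strain u l m) x))"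

definition equilibrium ::
  "(real^3) set \<Rightarrow> elastic_moduli \<Rightarrow> (real^3 \<Rightarrow> real^3) \<Rightarrow> bool" where
  "equilibrium \<Omega> \<mu> u \<longleftrightarrow> (\<forall>x\<in>\<Omega>. \<forall>i.
     (\<Sum>j\<in>UNIV. partial_deriv j (stress \<mu> u i j) x) -
     (\<Sum>j\<in>UNIV. \<Sum>k\<in>UNIV. partial_deriv k (partial_deriv j (hyper_stress \<mu> u i j k)) x) = 0)"

definition universal_displacement ::
  "elastic_moduli set \<Rightarrow> (real^3) set \<Rightarrow> (real^3 \<Rightarrow> real^3) \<Rightarrow> bool" where
  "universal_displacement cls \<Omega> u \<longleftrightarrow> (\<forall>\<mu>\<in>cls. equilibrium \<Omega> \<mu> u)"

definition O3 :: "(real^3^3) monoid" where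
  "O3 = \<lparr>carrier = {Q. orthogonal_matrix Q}, mult = (**), one = mat 1\<rparr>"

definition rotation_e2 :: "real \<Rightarrow> real^3^3" where
  "rotation_e2 t = vector [vector [cos t, 0, sin t],
                           vector [0, 1, 0],
                           vector [- sin t, 0, cos t]]"

definition rotation_e3 :: "real \<Rightarrow> real^3^3" where
  "rotation_e3 t = vector [vector [cos t, - sin t, 0],
                           vector [sin t, cos t, 0],
                           vector [0, 0, 1]]"

definition Z3 :: "(real^3^3) set" where
  "Z3 = generate O3 {rotation_e3 (2 * pi / 3)}"

definition D3 :: "(real^3^3) set" where
  "D3 = generate O3 (Z3 \<union> {rotation_e2 pi})"

definition plus_Z2c :: "(real^3^3) set \<Rightarrow> (real^3^3) set" where
  "plus_Z2c G = generate O3 (G \<union> {- mat 1})"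

definition invariant4 :: "(real^3^3) set \<Rightarrow> tensor4 \<Rightarrow> bool" where
  "invariant4 G T \<longleftrightarrow> (\<forall>Q\<in>G. \<forall>i j l m.
     (\<Sum>i'\<in>UNIV. \<Sum>j'\<in>UNIV. \<Sum>l'\<in>UNIV. \<Sum>m'\<in>UNIV.
        Q $ i $ i' * Q $ j $ j' * Q $ l $ l' * Q $ m $ m' * T i' j' l' m') = T i j l m)"

definition invariant6 :: "(real^3^3) set \<Rightarrow> tensor6 \<Rightarrow> bool" where
  "invariant6 G T \<longleftrightarrow> (\<forall>Q\<in>G. \<forall>i j k l m n.
     (\<Sum>i'\<in>UNIV. \<Sum>j'\<in>UNIV. \<Sum>k'\<in>UNIV. \<Sum>l'\<in>UNIV. \<Sum>m'\<in>UNIV. \<Sum>n'\<in>UNIV.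
        Q $ i $ i' * Q $ j $ j' * Q $ k $ k' * Q $ l $ l' * Q $ m $ m' * Q $ n $ n' *
        T i' j' k' l' m' n') = T i j k l m n)"

definition trigonal_class_Z3_Z2c :: "elastic_moduli set" where
  "trigonal_class_Z3_Z2c = {(C, M, A) \<in> strain_gradient_materials.
     invariant4 (plus_Z2c D3) C \<and> M = (\<lambda>_ _ _ _ _. 0) \<and> invariant6 (plus_Z2c Z3) A}"

end

theory Submission
  imports Defs
begin

text \<open>
  Since \<open>A = 0\<close> is admissible, a universal field satisfies the classical equilibrium equations for
  every trigonal \<open>C\<close>. Those \<open>C\<close> form the linear span of six tensors, and comparing coefficients gives
  14 pointwise linear relations between the 18 second derivatives of \<open>u\<close>, which leave only
  \<open>u\<^sub>1\<^sub>,\<^sub>1\<^sub>2\<close>, \<open>u\<^sub>1\<^sub>,\<^sub>1\<^sub>3\<close>, \<open>u\<^sub>1\<^sub>,\<^sub>2\<^sub>3\<close>, \<open>u\<^sub>2\<^sub>,\<^sub>1\<^sub>3\<close> free. Differentiating the relations once expresses every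
  third derivative by \<open>u\<^sub>1\<^sub>,\<^sub>1\<^sub>2\<^sub>3\<close>, and differentiating again shows that this one is constant.
  Integration on the convex set \<open>\<Omega>\<close> yields the five constants. Conversely, the resulting fields have
  affine second derivatives, so the term with \<open>A\<close>, which contains fourth derivatives only, vanishes.
\<close>

section \<open>Partial derivatives and smooth functions\<close>

text \<open>Both functions have the same derivatives at \<open>x\<close>, so the choice operator
  behind \<open>frechet_derivative\<close> picks the same one, whether or not they are
  differentiable there.\<close>

lemma partial_deriv_cong:
  assumes "open S" "x \<in> S" "\<And>y. y \<in> S \<Longrightarrow> f y = g y"
  shows "partial_deriv k f x = partial_deriv k g x"
proof -
  have "(f has_derivative D) (at x) \<longleftrightarrow> (g has_derivative D) (at x)" for D
    using assms has_derivative_transform_within_open[of f D x UNIV S g]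
      has_derivative_transform_within_open[of g D x UNIV S f] by auto
  then show ?thesis
    by (simp add: partial_deriv_def frechet_derivative_def)
qed

lemma has_derivative_imp_partial_deriv:
  assumes "(f has_derivative f') (at x)"
  shows "partial_deriv k f x = f' (axis k 1)"
  using frechet_derivative_at[OF assms] by (simp add: partial_deriv_def)

lemma partial_deriv_const [simp]: "partial_deriv k (\<lambda>_. c) = (\<lambda>_. 0)"
  by (simp add: partial_deriv_def fun_eq_iff)

lemma partial_deriv_add:
  assumes "f differentiable at x" "g differentiable at x"
  shows "partial_deriv k (\<lambda>y. f y + g y) x = partial_deriv k f x + partial_deriv k g x"
  using has_derivative_imp_partial_deriv[OF has_derivative_add
      [OF assms[THEN frechet_derivative_works[THEN iffD1]]]]
  by (simp add: partial_deriv_def)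

lemma partial_deriv_diff:
  assumes "f differentiable at x" "g differentiable at x"
  shows "partial_deriv k (\<lambda>y. f y - g y) x = partial_deriv k f x - partial_deriv k g x"
  using has_derivative_imp_partial_deriv[OF has_derivative_diff
      [OF assms[THEN frechet_derivative_works[THEN iffD1]]]]
  by (simp add: partial_deriv_def)

lemma partial_deriv_cmult:
  assumes "f differentiable at x"
  shows "partial_deriv k (\<lambda>y. c * f y) x = c * partial_deriv k f x"
  using has_derivative_imp_partial_deriv[OF has_derivative_mult_right
      [OF frechet_derivative_works[THEN iffD1, OF assms]]]
  by (simp add: partial_deriv_def)

lemma partial_deriv_sum:
  assumes "finite I" "\<And>i. i \<in> I \<Longrightarrow> f i differentiable at x"
  shows "partial_deriv k (\<lambda>y. \<Sum>i\<in>I. f i y) x = (\<Sum>i\<in>I. partial_deriv k (f i) x)"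
proof -
  have "((\<lambda>y. \<Sum>i\<in>I. f i y) has_derivative (\<lambda>h. \<Sum>i\<in>I. frechet_derivative (f i) (at x) h)) (at x)"
    using assms by (intro has_derivative_sum) (simp add: frechet_derivative_works)
  from has_derivative_imp_partial_deriv[OF this] show ?thesis
    by (simp add: partial_deriv_def)
qed

lemma smooth_on_imp_differentiable:
  assumes "smooth_on \<Omega> f" "open \<Omega>" "x \<in> \<Omega>"
  shows "f differentiable at x"
  using assms by (auto simp: smooth_on_def differentiable_on_eq_differentiable_at dest: spec[of _ "[]"])

lemma smooth_on_partial_deriv:
  assumes "smooth_on \<Omega> f"
  shows "smooth_on \<Omega> (partial_deriv k f)"
  unfolding smooth_on_def
proof
  fix ks
  show "foldr partial_deriv ks (partial_deriv k f) differentiable_on \<Omega>"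
    using assms[unfolded smooth_on_def, rule_format, of "ks @ [k]"] by simp
qed

lemma smooth_on_const: "smooth_on \<Omega> (\<lambda>_. c)"
proof -
  have "\<exists>d. foldr partial_deriv ks (\<lambda>_. c) = (\<lambda>_. d)" for ks
    by (induction ks) auto
  then show ?thesis
    unfolding smooth_on_def by (metis differentiable_on_const)
qed

lemma smooth_on_lincomb:
  assumes "open \<Omega>" "smooth_on \<Omega> f" "smooth_on \<Omega> g"
  shows "smooth_on \<Omega> (\<lambda>x. a * f x + b * g x)"
proof -
  have diff: "foldr partial_deriv ks h differentiable at x"
    if "smooth_on \<Omega> h" "x \<in> \<Omega>" for h ks x
    using that assms(1) by (simp add: smooth_on_def differentiable_on_eq_differentiable_at)
  \<comment> \<open>The identity is claimed on \<Omega> only, where all iterated derivatives are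
    differentiable; rewriting below a further derivative therefore goes through
    \<open>partial_deriv_cong\<close>.\<close>
  have eq: "foldr partial_deriv ks (\<lambda>x. a * f x + b * g x) x =
      a * foldr partial_deriv ks f x + b * foldr partial_deriv ks g x" if "x \<in> \<Omega>" for ks x
    using that
  proof (induction ks arbitrary: x)
    case (Cons k ks)
    have "partial_deriv k (foldr partial_deriv ks (\<lambda>x. a * f x + b * g x)) x =
        partial_deriv k (\<lambda>x. a * foldr partial_deriv ks f x + b * foldr partial_deriv ks g x) x"
      using partial_deriv_cong[OF assms(1) Cons.prems Cons.IH] .
    also have "\<dots> = a * partial_deriv k (foldr partial_deriv ks f) x
        + b * partial_deriv k (foldr partial_deriv ks g) x"
      using diff[OF assms(2) Cons.prems] diff[OF assms(3) Cons.prems]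
      by (simp add: partial_deriv_add partial_deriv_cmult differentiable_mult)
    finally show ?case by simp
  qed simp
  show ?thesis
    unfolding smooth_on_def
  proof
    fix ks
    have "(\<lambda>x. a * foldr partial_deriv ks f x + b * foldr partial_deriv ks g x) differentiable_on \<Omega>"
      using diff assms by (auto simp: differentiable_on_eq_differentiable_at intro!: differentiable_mult)
    then show "foldr partial_deriv ks (\<lambda>x. a * f x + b * g x) differentiable_on \<Omega>"
      using differentiable_transform_within eq unfolding differentiable_on_def
      by (metis (no_types, lifting) zero_less_one)
  qed
qed

section \<open>Symmetry of second partial derivatives\<close>

lemma has_real_derivative_along_line:
  assumes "f differentiable at (z + s *\<^sub>R axis k 1)"
  shows "((\<lambda>s. f (z + s *\<^sub>R axis k 1)) has_real_derivative partial_deriv k f (z + s *\<^sub>R axis k 1)) (at s)"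
proof -
  let ?D = "frechet_derivative f (at (z + s *\<^sub>R axis k 1))"
  have D: "(f has_derivative ?D) (at (z + s *\<^sub>R axis k 1))"
    using assms by (simp add: frechet_derivative_works)
  have "((\<lambda>s. z + s *\<^sub>R axis k 1) has_derivative (\<lambda>t. t *\<^sub>R axis k 1)) (at s)"
    by (auto intro!: derivative_eq_intros)
  from diff_chain_at[OF this D]
  have "((\<lambda>s. f (z + s *\<^sub>R axis k 1)) has_derivative (\<lambda>t. ?D (t *\<^sub>R axis k 1))) (at s)"
    by (simp add: o_def)
  moreover have "?D (t *\<^sub>R axis k 1) = partial_deriv k f (z + s *\<^sub>R axis k 1) * t" for t
    using linear_frechet_derivative[OF assms] by (simp add: linear_scale partial_deriv_def)
  ultimately show ?thesis
    by (simp add: has_field_derivative_def)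
qed

text \<open>The mean value theorem is applied twice, first along \<open>a\<close> and then along
  \<open>b\<close>. The second difference is symmetric in \<open>a\<close> and \<open>b\<close>
  while the right side is not, which is what makes the derivatives commute.\<close>

lemma second_difference_mvt:
  assumes "open \<Omega>" "smooth_on \<Omega> f" "ball x r \<subseteq> \<Omega>" "0 < h" "2 * h < r"
  shows "\<exists>y\<in>ball x r. f (x + h *\<^sub>R axis a 1 + h *\<^sub>R axis b 1) - f (x + h *\<^sub>R axis a 1)
      - f (x + h *\<^sub>R axis b 1) + f x = h\<^sup>2 * partial_deriv b (partial_deriv a f) y"
proof -
  \<comment> \<open>The triangle inequality bounds the displacement by \<open>s + t\<close>, which
    is at most \<open>2 * h\<close>, so the whole parallelogram stays in the ball.\<close>
  have mem: "x + s *\<^sub>R axis a 1 + t *\<^sub>R axis b 1 \<in> ball x r"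
    if "0 \<le> s" "s \<le> h" "0 \<le> t" "t \<le> h" for s t
  proof -
    have "norm (s *\<^sub>R axis a 1 + t *\<^sub>R axis b 1 :: real^3) \<le> s + t"
      using that norm_triangle_ineq[of "s *\<^sub>R axis a 1 :: real^3" "t *\<^sub>R axis b 1"]
      by (simp add: norm_axis_1)
    moreover have "dist x (x + s *\<^sub>R axis a 1 + t *\<^sub>R axis b 1)
        = norm (s *\<^sub>R axis a 1 + t *\<^sub>R axis b 1 :: real^3)"
      unfolding dist_norm by (metis add.assoc add_diff_cancel_left' norm_minus_commute)
    ultimately show ?thesis
      using that assms(5) by simp
  qed
  have diff: "g differentiable at (x + s *\<^sub>R axis a 1 + t *\<^sub>R axis b 1)"
    if "smooth_on \<Omega> g" "0 \<le> s" "s \<le> h" "0 \<le> t" "t \<le> h" for s t g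
    using mem[OF that(2-5)] assms(3) smooth_on_imp_differentiable[OF that(1) assms(1)] by blast
  let ?g = "\<lambda>s. f (x + s *\<^sub>R axis a 1 + h *\<^sub>R axis b 1) - f (x + s *\<^sub>R axis a 1)"
  let ?F = "\<lambda>s t. partial_deriv a f (x + s *\<^sub>R axis a 1 + t *\<^sub>R axis b 1)"
  have "(?g has_real_derivative ?F s h - ?F s 0) (at s)" if "0 \<le> s" "s \<le> h" for s
  proof -
    have "((\<lambda>s. f ((x + h *\<^sub>R axis b 1) + s *\<^sub>R axis a 1)) has_real_derivative
        partial_deriv a f ((x + h *\<^sub>R axis b 1) + s *\<^sub>R axis a 1)) (at s)"
      using diff[OF assms(2) that, of h] assms(4)
      by (intro has_real_derivative_along_line) (simp add: ac_simps)
    moreover have "((\<lambda>s. f (x + s *\<^sub>R axis a 1)) has_real_derivative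
        partial_deriv a f (x + s *\<^sub>R axis a 1)) (at s)"
      using diff[OF assms(2) that, of 0] assms(4)
      by (intro has_real_derivative_along_line) simp
    ultimately show ?thesis
      using DERIV_diff by (fastforce simp: ac_simps)
  qed
  from MVT2[OF assms(4) this] obtain \<xi> where
    \<xi>: "0 < \<xi>" "\<xi> < h" "?g h - ?g 0 = h * (?F \<xi> h - ?F \<xi> 0)"
    by force
  have "(?F \<xi> has_real_derivative
      partial_deriv b (partial_deriv a f) (x + \<xi> *\<^sub>R axis a 1 + t *\<^sub>R axis b 1)) (at t)"
    if "0 \<le> t" "t \<le> h" for t
    using diff[OF smooth_on_partial_deriv[OF assms(2)] _ _ that, of \<xi>] \<xi>
    by (intro has_real_derivative_along_line) simp
  from MVT2[OF assms(4) this] obtain \<eta> where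
    \<eta>: "0 < \<eta>" "\<eta> < h" "?F \<xi> h - ?F \<xi> 0 =
        h * partial_deriv b (partial_deriv a f) (x + \<xi> *\<^sub>R axis a 1 + \<eta> *\<^sub>R axis b 1)"
    by force
  show ?thesis
    using mem[of \<xi> \<eta>] \<xi> \<eta> by (intro bexI) (auto simp: power2_eq_square)
qed

lemma partial_deriv_commute:
  assumes "open \<Omega>" "smooth_on \<Omega> f" "x \<in> \<Omega>"
  shows "partial_deriv a (partial_deriv b f) x = partial_deriv b (partial_deriv a f) x"
proof (rule ccontr)
  let ?P = "partial_deriv a (partial_deriv b f)" and ?Q = "partial_deriv b (partial_deriv a f)"
  assume ne: "?P x \<noteq> ?Q x"
  \<comment> \<open>Half the gap: values within \<open>e\<close> of \<open>?P x\<close> and of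
    \<open>?Q x\<close> respectively cannot coincide.\<close>
  define e where "e = \<bar>?P x - ?Q x\<bar> / 2"
  have "e > 0" using ne by (simp add: e_def)
  have "isCont ?P x" "isCont ?Q x"
    using assms by (auto intro!: differentiable_imp_continuous_within
        smooth_on_imp_differentiable[OF _ assms(1,3)] smooth_on_partial_deriv)
  then obtain d1 d2 where d: "d1 > 0" "d2 > 0"
    "\<And>y. dist y x < d1 \<Longrightarrow> dist (?P y) (?P x) < e" "\<And>y. dist y x < d2 \<Longrightarrow> dist (?Q y) (?Q x) < e"
    using \<open>e > 0\<close> unfolding continuous_at_eps_delta by metis
  obtain d3 where d3: "d3 > 0" "ball x d3 \<subseteq> \<Omega>"
    using assms open_contains_ball by blast
  define r where "r = min d3 (min d1 d2)"
  have r: "r > 0" "ball x r \<subseteq> \<Omega>" using d d3 by (auto simp: r_def)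
  define h where "h = r / 3"
  have h: "0 < h" "2 * h < r" using r by (auto simp: h_def)
  \<comment> \<open>Both orders of differentiation are compared with the same second difference, at
    two possibly different points of the ball.\<close>
  obtain y z where yz: "y \<in> ball x r" "z \<in> ball x r" "h\<^sup>2 * ?P y = h\<^sup>2 * ?Q z"
    using second_difference_mvt[OF assms(1,2) r(2) h, of a b]
      second_difference_mvt[OF assms(1,2) r(2) h, of b a]
    by (auto simp: algebra_simps)
  have "?P y = ?Q z" using yz(3) h by simp
  moreover have "dist y x < d1" "dist z x < d2"
    using yz by (auto simp: r_def dist_commute)
  then have "dist (?P y) (?P x) < e" "dist (?Q z) (?Q x) < e"
    using d by blast+
  ultimately show False
    unfolding e_def dist_real_def by (simp add: abs_if split: if_splits)
qed

lemma partial_deriv_zero_imp_constant: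
  assumes "convex \<Omega>" "open \<Omega>" "\<And>x. x \<in> \<Omega> \<Longrightarrow> f differentiable at x"
    and "\<And>k x. x \<in> \<Omega> \<Longrightarrow> partial_deriv k f x = 0"
  shows "\<exists>c. \<forall>x\<in>\<Omega>. f x = c"
proof -
  have "(f has_derivative (\<lambda>_. 0)) (at x within \<Omega>)" if x: "x \<in> \<Omega>" for x
  proof -
    let ?D = "frechet_derivative f (at x)"
    have D: "(f has_derivative ?D) (at x)"
      using assms(3)[OF x] by (simp add: frechet_derivative_works)
    \<comment> \<open>By linearity the derivative is determined by its values on the basis vectors,
      which are the partial derivatives.\<close>
    have "?D v = 0" for v
    proof -
      have "?D (\<Sum>k\<in>UNIV. v $ k *\<^sub>R axis k 1) = (\<Sum>k\<in>UNIV. v $ k * partial_deriv k f x)"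
        using has_derivative_linear[OF D] by (simp add: linear_sum linear_scale partial_deriv_def)
      moreover have "(\<Sum>k\<in>UNIV. v $ k *\<^sub>R axis k 1) = v"
        by (simp add: vec_eq_iff axis_def if_distrib cong: if_cong)
      ultimately show ?thesis using assms(4)[OF x] by simp
    qed
    then have "?D = (\<lambda>_. 0)" by auto
    then show ?thesis using D has_derivative_at_withinI by metis
  qed
  from has_derivative_zero_constant[OF assms(1) this] show ?thesis by blast
qed

text \<open>\<open>foldr\<close> applies the last index first, so the list is split at its end: the
  last index acts on \<open>f\<close> and the rest acts on a function already known to be
  smooth.\<close>

lemma smooth_onI:
  assumes "open \<Omega>" "\<And>x. x \<in> \<Omega> \<Longrightarrow> f differentiable at x" "\<And>k. smooth_on \<Omega> (partial_deriv k f)"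
  shows "smooth_on \<Omega> f"
  unfolding smooth_on_def
proof
  fix ks
  show "foldr partial_deriv ks f differentiable_on \<Omega>"
  proof (cases ks rule: rev_cases)
    case Nil
    then show ?thesis
      using assms by (simp add: differentiable_on_eq_differentiable_at)
  next
    case (snoc ks' k)
    then show ?thesis
      using assms(3)[of k] by (simp add: smooth_on_def)
  qed
qed

lemma smooth_on_diff:
  assumes "open \<Omega>" "smooth_on \<Omega> f" "smooth_on \<Omega> g"
  shows "smooth_on \<Omega> (\<lambda>x. f x - g x)"
  using smooth_on_lincomb[OF assms, of 1 "- 1"] by simp

lemma second_partial_deriv_diff:
  assumes "open \<Omega>" "smooth_on \<Omega> f" "smooth_on \<Omega> g" "x \<in> \<Omega>"
  shows "partial_deriv n (partial_deriv m (\<lambda>y. f y - g y)) x =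
    partial_deriv n (partial_deriv m f) x - partial_deriv n (partial_deriv m g) x"
proof -
  note diff = smooth_on_imp_differentiable[OF _ assms(1)]
  have "partial_deriv n (partial_deriv m (\<lambda>y. f y - g y)) x =
      partial_deriv n (\<lambda>y. partial_deriv m f y - partial_deriv m g y) x"
    using assms by (intro partial_deriv_cong[OF assms(1,4)] partial_deriv_diff diff)
  also have "\<dots> = partial_deriv n (partial_deriv m f) x - partial_deriv n (partial_deriv m g) x"
    using assms by (intro partial_deriv_diff diff smooth_on_partial_deriv)
  finally show ?thesis .
qed

section \<open>Symbolic differentiation of polynomials\<close>

lemma component_differentiable: "(\<lambda>x :: real^3. x $ k) differentiable at x"
  using bounded_linear_imp_differentiable[OF bounded_linear_vec_nth] .

lemma partial_deriv_component: "partial_deriv k (\<lambda>x. x $ l) x = axis k 1 $ l"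
  by (rule has_derivative_imp_partial_deriv)
    (intro bounded_linear_imp_has_derivative bounded_linear_vec_nth)

lemma partial_deriv_mult:
  assumes "f differentiable at x" "g differentiable at x"
  shows "partial_deriv k (\<lambda>y. f y * g y) x = f x * partial_deriv k g x + partial_deriv k f x * g x"
  using has_derivative_imp_partial_deriv[OF has_derivative_mult
      [OF assms[THEN frechet_derivative_works[THEN iffD1]]]]
  by (simp add: partial_deriv_def)

lemma partial_deriv_minus:
  assumes "f differentiable at x"
  shows "partial_deriv k (\<lambda>y. - f y) x = - partial_deriv k f x"
  using partial_deriv_cmult[OF assms, of k "- 1"] by simp

lemma partial_deriv_divide:
  assumes "f differentiable at x"
  shows "partial_deriv k (\<lambda>y. f y / c) x = partial_deriv k f x / c"
  using partial_deriv_cmult[OF assms, of k "inverse c"] by (simp add: divide_inverse_commute)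

lemma differentiable_divide_const:
  fixes f :: "real^3 \<Rightarrow> real"
  assumes "f differentiable at x"
  shows "(\<lambda>y. f y / c) differentiable at x"
  using differentiable_mult[OF assms differentiable_const[of "inverse c"]]
  by (simp add: divide_inverse)

lemmas partial_deriv_polynomial = partial_deriv_minus partial_deriv_divide
  differentiable_divide_const partial_deriv_add partial_deriv_diff partial_deriv_mult
  partial_deriv_component component_differentiable

section \<open>Affine functions\<close>

text \<open>Serves two purposes: it describes the components of homogeneous fields, and it is the
  form taken by the second derivatives of universal fields.\<close>

definition affine_fun_on :: "(real^3) set \<Rightarrow> (real^3 \<Rightarrow> real) \<Rightarrow> bool" where
  "affine_fun_on \<Omega> f \<longleftrightarrow> (\<exists>c v. \<forall>x\<in>\<Omega>. f x = c + v \<bullet> x)"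

lemma partial_deriv_affine: "partial_deriv k (\<lambda>x. c + v \<bullet> x) = (\<lambda>_. v $ k)"
proof
  fix x
  have "((\<lambda>x. c + v \<bullet> x) has_derivative (\<lambda>h. v \<bullet> h)) (at x)"
    by (auto intro!: derivative_eq_intros)
  from has_derivative_imp_partial_deriv[OF this] show "partial_deriv k (\<lambda>x. c + v \<bullet> x) x = v $ k"
    by (simp add: inner_axis)
qed

lemma affine_fun_on_imp_second_partials_zero:
  assumes "open \<Omega>" "affine_fun_on \<Omega> f" "x \<in> \<Omega>"
  shows "partial_deriv n (partial_deriv m f) x = 0"
proof -
  obtain c v where f: "\<And>y. y \<in> \<Omega> \<Longrightarrow> f y = c + v \<bullet> y"
    using assms(2) by (auto simp: affine_fun_on_def)
  have "partial_deriv m f y = v $ m" if "y \<in> \<Omega>" for y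
    using partial_deriv_cong[OF assms(1) that f] by (simp add: partial_deriv_affine)
  from partial_deriv_cong[OF assms(1,3) this] show ?thesis by simp
qed

text \<open>Subtracting the linear function with gradient \<open>v\<close> leaves a function whose
  gradient vanishes on a convex set.\<close>

lemma constant_gradient_imp_affine:
  assumes "convex \<Omega>" "open \<Omega>" "\<And>x. x \<in> \<Omega> \<Longrightarrow> f differentiable at x"
    and "\<And>k x. x \<in> \<Omega> \<Longrightarrow> partial_deriv k f x = v $ k"
  shows "\<exists>c. \<forall>x\<in>\<Omega>. f x = c + v \<bullet> x"
proof -
  have lin: "(\<lambda>x. v \<bullet> x) differentiable at x" for x
    by (intro differentiable_inner) auto
  have "\<exists>c. \<forall>x\<in>\<Omega>. f x - v \<bullet> x = c"
    using assms lin partial_deriv_affine[of _ 0 v]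
    by (intro partial_deriv_zero_imp_constant) (auto simp: partial_deriv_diff intro!: differentiable_diff)
  then show ?thesis
    by (metis add.commute diff_eq_eq)
qed

text \<open>Two integrations: the first derivatives have zero gradient and are constant, and these
  constants form the gradient of \<open>f\<close>.\<close>

lemma second_partials_zero_imp_affine:
  assumes "convex \<Omega>" "open \<Omega>" "smooth_on \<Omega> f"
    and "\<And>m n x. x \<in> \<Omega> \<Longrightarrow> partial_deriv n (partial_deriv m f) x = 0"
  shows "affine_fun_on \<Omega> f"
proof -
  have "\<exists>c. \<forall>x\<in>\<Omega>. partial_deriv m f x = c" for m
    using assms by (intro partial_deriv_zero_imp_constant)
      (auto intro: smooth_on_imp_differentiable smooth_on_partial_deriv)
  then obtain c where c: "\<And>m x. x \<in> \<Omega> \<Longrightarrow> partial_deriv m f x = c m" by metis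
  have "\<exists>b. \<forall>x\<in>\<Omega>. f x = b + (\<chi> m. c m) \<bullet> x"
    using assms c
    by (intro constant_gradient_imp_affine) (auto intro: smooth_on_imp_differentiable)
  then show ?thesis
    by (auto simp: affine_fun_on_def)
qed

lemma affine_fun_on_const: "affine_fun_on \<Omega> (\<lambda>_. c)"
  unfolding affine_fun_on_def by (rule exI[of _ c], rule exI[of _ 0]) simp

lemma affine_fun_on_add:
  assumes "affine_fun_on \<Omega> f" "affine_fun_on \<Omega> g"
  shows "affine_fun_on \<Omega> (\<lambda>x. f x + g x)"
proof -
  obtain c v d w where "\<forall>x\<in>\<Omega>. f x = c + v \<bullet> x" "\<forall>x\<in>\<Omega>. g x = d + w \<bullet> x"
    using assms by (auto simp: affine_fun_on_def)
  then have "\<forall>x\<in>\<Omega>. f x + g x = (c + d) + (v + w) \<bullet> x"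
    by (simp add: inner_add_left)
  then show ?thesis unfolding affine_fun_on_def by blast
qed

lemma affine_fun_on_cmult:
  assumes "affine_fun_on \<Omega> f"
  shows "affine_fun_on \<Omega> (\<lambda>x. a * f x)"
proof -
  obtain c v where "\<forall>x\<in>\<Omega>. f x = c + v \<bullet> x"
    using assms by (auto simp: affine_fun_on_def)
  then have "\<forall>x\<in>\<Omega>. a * f x = a * c + (a *\<^sub>R v) \<bullet> x"
    by (simp add: algebra_simps)
  then show ?thesis unfolding affine_fun_on_def by blast
qed

lemma affine_fun_on_sum:
  assumes "\<And>i. i \<in> I \<Longrightarrow> affine_fun_on \<Omega> (f i)"
  shows "affine_fun_on \<Omega> (\<lambda>x. \<Sum>i\<in>I. f i x)"
  using assms
  by (induction I rule: infinite_finite_induct) (auto intro: affine_fun_on_const affine_fun_on_add)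

lemma affine_fun_on_component: "affine_fun_on \<Omega> (\<lambda>x. x $ k)"
  unfolding affine_fun_on_def
  by (rule exI[of _ 0], rule exI[of _ "axis k 1"]) (simp add: inner_axis')

lemma affine_fun_on_cong:
  assumes "affine_fun_on \<Omega> f" "\<And>x. x \<in> \<Omega> \<Longrightarrow> f x = g x"
  shows "affine_fun_on \<Omega> g"
  using assms by (simp add: affine_fun_on_def)

lemma homogeneous_iff: "homogeneous \<Omega> u \<longleftrightarrow> (\<forall>l. affine_fun_on \<Omega> (\<lambda>x. u x $ l))"
proof
  assume "homogeneous \<Omega> u"
  then obtain H b where "\<And>x. x \<in> \<Omega> \<Longrightarrow> u x = H *v x + b"
    by (auto simp: homogeneous_def)
  then have "\<forall>x\<in>\<Omega>. u x $ l = b $ l + H $ l \<bullet> x" for l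
    by (simp add: matrix_vector_mult_def inner_vec_def)
  then show "\<forall>l. affine_fun_on \<Omega> (\<lambda>x. u x $ l)"
    unfolding affine_fun_on_def by blast
next
  assume "\<forall>l. affine_fun_on \<Omega> (\<lambda>x. u x $ l)"
  then obtain c v where *: "\<And>l x. x \<in> \<Omega> \<Longrightarrow> u x $ l = c l + v l \<bullet> x"
    unfolding affine_fun_on_def by metis
  have "\<forall>x\<in>\<Omega>. u x = (\<chi> l. v l) *v x + (\<chi> l. c l)"
    by (simp add: * vec_eq_iff matrix_vector_mult_def inner_vec_def)
  then show "homogeneous \<Omega> u"
    unfolding homogeneous_def by blast
qed

section \<open>Invariant elasticity tensors\<close>

text \<open>The action of orthogonal matrices on tensors, isolated so that invariance becomes a
  fixed-point condition and stabilizers can be treated as groups.\<close>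

definition rotate4 :: "real^3^3 \<Rightarrow> tensor4 \<Rightarrow> tensor4" where
  "rotate4 Q T i j l m = (\<Sum>i'\<in>UNIV. \<Sum>j'\<in>UNIV. \<Sum>l'\<in>UNIV. \<Sum>m'\<in>UNIV.
     Q $ i $ i' * Q $ j $ j' * Q $ l $ l' * Q $ m $ m' * T i' j' l' m')"

lemma invariant4_iff: "invariant4 G T \<longleftrightarrow> (\<forall>Q\<in>G. rotate4 Q T = T)"
  by (simp add: invariant4_def rotate4_def fun_eq_iff)

text \<open>With the factors pulled out of the inner sums, a concrete matrix can be evaluated one
  row at a time instead of over all 81 index tuples.\<close>

lemma rotate4_nested:
  "rotate4 Q T i j l m = (\<Sum>i'\<in>UNIV. Q $ i $ i' * (\<Sum>j'\<in>UNIV. Q $ j $ j' *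
     (\<Sum>l'\<in>UNIV. Q $ l $ l' * (\<Sum>m'\<in>UNIV. Q $ m $ m' * T i' j' l' m'))))"
  by (simp only: rotate4_def sum_distrib_left mult.assoc)

lemma rotate4_one: "rotate4 (mat 1) T = T"
proof -
  have "(\<Sum>k\<in>UNIV. (mat 1 :: real^3^3) $ i $ k * f k) = f i" for i f
    by (simp add: mat_def if_distrib[of "\<lambda>c. c * _"] cong: if_cong)
  then show ?thesis
    by (simp add: fun_eq_iff rotate4_nested)
qed

text \<open>
  A rotation of all four slots is the composition of four commuting rotations of single slots,
  each of which is multiplicative in the matrix.
\<close>

lemma rotate4_mult: "rotate4 (P ** Q) T = rotate4 P (rotate4 Q T)"
proof -
  define s1 where "s1 A T = (\<lambda>i j l m. \<Sum>k\<in>UNIV. A $ i $ k * T k j l m)"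
    for A :: "real^3^3" and T :: tensor4
  define s2 where "s2 A T = (\<lambda>i j l m. \<Sum>k\<in>UNIV. A $ j $ k * T i k l m)"
    for A :: "real^3^3" and T :: tensor4
  define s3 where "s3 A T = (\<lambda>i j l m. \<Sum>k\<in>UNIV. A $ l $ k * T i j k m)"
    for A :: "real^3^3" and T :: tensor4
  define s4 where "s4 A T = (\<lambda>i j l m. \<Sum>k\<in>UNIV. A $ m $ k * T i j l k)"
    for A :: "real^3^3" and T :: tensor4
  note defs = s1_def s2_def s3_def s4_def
  have split: "rotate4 A U = s1 A (s2 A (s3 A (s4 A U)))" for A U
    by (simp only: fun_eq_iff rotate4_nested defs simp_thms)
  have slot: "(\<Sum>k\<in>UNIV. (P ** Q) $ i $ k * f k) = (\<Sum>k\<in>UNIV. P $ i $ k * (\<Sum>l\<in>UNIV. Q $ k $ l * f l))"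
    for i and f :: "3 \<Rightarrow> real"
  proof -
    have "(\<Sum>k\<in>UNIV. (P ** Q) $ i $ k * f k) = (\<Sum>k\<in>UNIV. \<Sum>l\<in>UNIV. P $ i $ l * (Q $ l $ k * f k))"
      by (simp add: matrix_matrix_mult_def sum_distrib_right mult.assoc)
    also have "\<dots> = (\<Sum>k\<in>UNIV. P $ i $ k * (\<Sum>l\<in>UNIV. Q $ k $ l * f l))"
      unfolding sum_distrib_left by (rule sum.swap)
    finally show ?thesis .
  qed
  have mult: "s1 (P ** Q) U = s1 P (s1 Q U)" "s2 (P ** Q) U = s2 P (s2 Q U)"
    "s3 (P ** Q) U = s3 P (s3 Q U)" "s4 (P ** Q) U = s4 P (s4 Q U)" for U
    unfolding defs by (simp_all only: slot)
  have swap: "(\<Sum>k\<in>UNIV. a k * (\<Sum>l\<in>UNIV. b l * f k l)) = (\<Sum>l\<in>UNIV. b l * (\<Sum>k\<in>UNIV. a k * f k l))"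
    for a b :: "3 \<Rightarrow> real" and f
    unfolding sum_distrib_left
    by (subst sum.swap) (simp only: mult.left_commute)
  have commute: "s2 P (s1 Q U) = s1 Q (s2 P U)" "s3 P (s1 Q U) = s1 Q (s3 P U)"
    "s4 P (s1 Q U) = s1 Q (s4 P U)" "s3 P (s2 Q U) = s2 Q (s3 P U)"
    "s4 P (s2 Q U) = s2 Q (s4 P U)" "s4 P (s3 Q U) = s3 Q (s4 P U)" for U
    unfolding defs fun_eq_iff by (intro allI swap)+
  show ?thesis
    unfolding split mult by (simp only: commute)
qed

section \<open>Reduction of invariance to generators\<close>

lemma group_O3: "group O3"
proof (rule groupI)
  fix Q assume "Q \<in> carrier O3"
  then show "\<exists>P\<in>carrier O3. P \<otimes>\<^bsub>O3\<^esub> Q = \<one>\<^bsub>O3\<^esub>"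
    by (intro bexI[of _ "transpose Q"])
      (auto simp: O3_def orthogonal_matrix_def transpose_transpose)
qed (auto simp: O3_def orthogonal_matrix_mul orthogonal_matrix_id matrix_mul_assoc)

text \<open>The stabilizer of \<open>T\<close> is a subgroup of \<open>O3\<close>; containing
  \<open>H\<close>, it contains the group generated by \<open>H\<close>.\<close>

lemma invariant4_generate:
  assumes "H \<subseteq> carrier O3" "invariant4 H T"
  shows "invariant4 (generate O3 H) T"
proof -
  interpret group O3 by (rule group_O3)
  let ?S = "{Q \<in> carrier O3. rotate4 Q T = T}"
  have "subgroup ?S O3"
  proof (rule subgroupI)
    show "?S \<noteq> {}"
      using rotate4_one one_closed by (auto simp: O3_def)
    fix Q assume Q: "Q \<in> ?S"
    \<comment> \<open>Since \<open>Q\<close> fixes \<open>T\<close>, applying the inverse to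
      \<open>T\<close> is the same as applying the inverse after \<open>Q\<close>.\<close>
    have "rotate4 (inv\<^bsub>O3\<^esub> Q) T = rotate4 (inv\<^bsub>O3\<^esub> Q ** Q) T"
      using Q by (simp add: rotate4_mult)
    also have "inv\<^bsub>O3\<^esub> Q ** Q = mat 1"
      using Q l_inv by (simp add: O3_def)
    finally show "inv\<^bsub>O3\<^esub> Q \<in> ?S"
      using Q by (simp add: rotate4_one)
  next
    fix P Q assume "P \<in> ?S" "Q \<in> ?S"
    then show "P \<otimes>\<^bsub>O3\<^esub> Q \<in> ?S"
      using m_closed by (auto simp: rotate4_mult O3_def)
  qed auto
  from generate_subgroup_incl[OF _ this] assms show ?thesis
    by (auto simp: invariant4_iff)
qed

lemma orthogonal_rotations:
  "rotation_e3 t \<in> carrier O3" "rotation_e2 t \<in> carrier O3" "- mat 1 \<in> carrier O3"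
  by (auto simp: O3_def orthogonal_matrix_def rotation_e3_def rotation_e2_def vec_eq_iff forall_3
      transpose_def matrix_matrix_mult_def sum_3 mat_def power2_eq_square[symmetric])

text \<open>The group is generated in three stages, and invariance passes from generators to the
  generated group at each of them, so two matrices suffice as a test.\<close>

lemma invariant4_plus_Z2c_D3_iff:
  "invariant4 (plus_Z2c D3) T \<longleftrightarrow>
     rotate4 (rotation_e3 (2 * pi / 3)) T = T \<and> rotate4 (rotation_e2 pi) T = T"
proof
  assume "invariant4 (plus_Z2c D3) T"
  moreover have "rotation_e3 (2 * pi / 3) \<in> plus_Z2c D3" "rotation_e2 pi \<in> plus_Z2c D3"
    by (auto simp: plus_Z2c_def D3_def Z3_def intro!: generate.incl)
  ultimately show "rotate4 (rotation_e3 (2 * pi / 3)) T = T \<and> rotate4 (rotation_e2 pi) T = T"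
    by (auto simp: invariant4_iff)
next
  assume *: "rotate4 (rotation_e3 (2 * pi / 3)) T = T \<and> rotate4 (rotation_e2 pi) T = T"
  interpret group O3 by (rule group_O3)
  have "invariant4 Z3 T"
    unfolding Z3_def using * orthogonal_rotations
    by (intro invariant4_generate) (auto simp: invariant4_iff)
  then have "invariant4 D3 T"
    unfolding D3_def using * orthogonal_rotations generate_incl[of "{rotation_e3 (2 * pi / 3)}"]
    by (intro invariant4_generate) (auto simp: invariant4_iff Z3_def)
  moreover have "D3 \<subseteq> carrier O3"
    unfolding D3_def using orthogonal_rotations generate_incl[of "{rotation_e3 (2 * pi / 3)}"]
    by (intro generate_incl) (auto simp: Z3_def)
  \<comment> \<open>The four signs cancel: inversion fixes every tensor of even order.\<close>
  moreover have "rotate4 (- mat 1) T = T"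
    using rotate4_one[of T] by (simp add: rotate4_def fun_eq_iff)
  ultimately show "invariant4 (plus_Z2c D3) T"
    unfolding plus_Z2c_def using orthogonal_rotations
    by (intro invariant4_generate) (auto simp: invariant4_iff)
qed

section \<open>Normal form of the trigonal elasticity tensors\<close>

definition planar_delta :: "3 \<Rightarrow> 3 \<Rightarrow> real" where
  "planar_delta i j = of_bool (i = j \<and> i \<noteq> 3)"

definition axial :: "3 \<Rightarrow> real" where
  "axial i = of_bool (i = 3)"

text \<open>The coefficients of the cubic form \<open>Re (x\<^sub>1 + i x\<^sub>2)^3 = x\<^sub>1^3 - 3 x\<^sub>1 x\<^sub>2^2\<close>.\<close>

definition triangle :: "3 \<Rightarrow> 3 \<Rightarrow> 3 \<Rightarrow> real" where
  "triangle i j k =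
     of_bool (i = 1 \<and> j = 1 \<and> k = 1) - of_bool (i = 1 \<and> j = 2 \<and> k = 2)
     - of_bool (i = 2 \<and> j = 1 \<and> k = 2) - of_bool (i = 2 \<and> j = 2 \<and> k = 1)"

text \<open>The constants carry their Voigt names (13 is abbreviated to 5, 12 to 6). The first five
  terms are unchanged by every rotation about the third axis; the \<open>c15\<close> term, built
  from the cubic form, has only threefold symmetry about it.\<close>

definition trigonal_C :: "real \<Rightarrow> real \<Rightarrow> real \<Rightarrow> real \<Rightarrow> real \<Rightarrow> real \<Rightarrow> tensor4" where
  "trigonal_C c12 c66 c13 c33 c44 c15 i j l m =
     c12 * (planar_delta i j * planar_delta l m)
   + c66 * (planar_delta i l * planar_delta j m + planar_delta i m * planar_delta j l)
   + c13 * (planar_delta i j * axial l * axial m + axial i * axial j * planar_delta l m)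
   + c33 * (axial i * axial j * axial l * axial m)
   + c44 * (planar_delta i l * axial j * axial m + planar_delta i m * axial j * axial l
          + planar_delta j l * axial i * axial m + planar_delta j m * axial i * axial l)
   + c15 * (triangle i j l * axial m + triangle i j m * axial l
          + triangle l m i * axial j + triangle l m j * axial i)"

lemmas trigonal_C_simps = trigonal_C_def planar_delta_def axial_def triangle_def

text \<open>Collapses the repeated factors of \<open>sqrt 3\<close> that arise when the rotation by
  120 degrees acts on several slots.\<close>

lemma sqrt_3_mult: "sqrt 3 * (sqrt 3 * x) = 3 * x"
  by (simp flip: mult.assoc)

lemma sum_row_rotation_e3:
  "(\<Sum>k\<in>UNIV. rotation_e3 (2 * pi / 3) $ 1 $ k * f k) = - f 1 / 2 - sqrt 3 / 2 * f 2"
  "(\<Sum>k\<in>UNIV. rotation_e3 (2 * pi / 3) $ 2 $ k * f k) = sqrt 3 / 2 * f 1 - f 2 / 2"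
  "(\<Sum>k\<in>UNIV. rotation_e3 (2 * pi / 3) $ 3 $ k * f k) = f 3"
  by (simp_all add: sum_3 rotation_e3_def cos_120 sin_120)

lemma sum_row_rotation_e2:
  "(\<Sum>k\<in>UNIV. rotation_e2 pi $ 1 $ k * f k) = - f 1"
  "(\<Sum>k\<in>UNIV. rotation_e2 pi $ 2 $ k * f k) = f 2"
  "(\<Sum>k\<in>UNIV. rotation_e2 pi $ 3 $ k * f k) = - f 3"
  by (simp_all add: sum_3 rotation_e2_def)

lemma rotate4_e2_trigonal_C:
  "rotate4 (rotation_e2 pi) (trigonal_C a b c d e f) = trigonal_C a b c d e f"
  by (simp only: fun_eq_iff forall_3 rotate4_nested sum_row_rotation_e2)
    (simp add: trigonal_C_simps)

lemma rotate4_e3_trigonal_C: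
  "rotate4 (rotation_e3 (2 * pi / 3)) (trigonal_C a b c d e f) = trigonal_C a b c d e f"
  by (simp only: fun_eq_iff forall_3 rotate4_nested sum_row_rotation_e3)
    (simp add: trigonal_C_simps field_simps sqrt_3_mult)

lemma trigonal_C_representation:
  assumes sym: "\<And>i j l m. C i j l m = C j i l m" "\<And>i j l m. C i j l m = C l m i j"
    and e2: "rotate4 (rotation_e2 pi) C = C"
    and e3: "rotate4 (rotation_e3 (2 * pi / 3)) C = C"
  shows "C = trigonal_C (C 1 1 2 2) (C 1 2 1 2) (C 1 1 3 3) (C 3 3 3 3) (C 1 3 1 3) (C 1 1 1 3)"
proof -
  \<comment> \<open>The minor and major symmetries, oriented as rewrite rules, reduce the 81
    components to 21.\<close>
  have minor [simp]: "C 2 1 l m = C 1 2 l m" "C 3 1 l m = C 1 3 l m" "C 3 2 l m = C 2 3 l m"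
    "C l m 2 1 = C l m 1 2" "C l m 3 1 = C l m 1 3" "C l m 3 2 = C l m 2 3" for l m
    by (metis sym)+
  have major [simp]: "C 1 2 1 1 = C 1 1 1 2" "C 1 3 1 1 = C 1 1 1 3" "C 2 2 1 1 = C 1 1 2 2"
    "C 2 3 1 1 = C 1 1 2 3" "C 3 3 1 1 = C 1 1 3 3"
    "C 1 3 1 2 = C 1 2 1 3" "C 2 2 1 2 = C 1 2 2 2" "C 2 3 1 2 = C 1 2 2 3" "C 3 3 1 2 = C 1 2 3 3"
    "C 2 2 1 3 = C 1 3 2 2" "C 2 3 1 3 = C 1 3 2 3" "C 3 3 1 3 = C 1 3 3 3"
    "C 2 3 2 2 = C 2 2 2 3" "C 3 3 2 2 = C 2 2 3 3" "C 3 3 2 3 = C 2 3 3 3"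
    by (rule sym(2))+
  have e2': "rotate4 (rotation_e2 pi) C i j l m = C i j l m"
    and e3': "rotate4 (rotation_e3 (2 * pi / 3)) C i j l m = C i j l m" for i j l m
    by (simp_all only: e2 e3)
  \<comment> \<open>The half turn about the second axis changes the sign of indices 1 and 3, so a
    component with an odd number of indices 2 equals its negative. This removes 8 of the 21.\<close>
  have odd [simp]: "C 1 1 1 2 = 0" "C 1 1 2 3 = 0" "C 1 2 1 3 = 0" "C 1 2 2 2 = 0" "C 1 2 3 3 = 0"
    "C 1 3 2 3 = 0" "C 2 2 2 3 = 0" "C 2 3 3 3 = 0"
    using e2'[of 1 1 1 2] e2'[of 1 1 2 3] e2'[of 1 2 1 3] e2'[of 1 2 2 2] e2'[of 1 2 3 3]
      e2'[of 1 3 2 3] e2'[of 2 2 2 3] e2'[of 2 3 3 3]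
    by (simp_all only: rotate4_nested sum_row_rotation_e2)
  note rows = rotate4_nested sum_row_rotation_e3
  \<comment> \<open>Invariance under a third of a turn gives linear equations for the remaining 13
    components; the seven relations drawn from them leave six free constants.\<close>
  have "C 1 1 1 1 = C 1 1 2 2 + 2 * C 1 2 1 2" "C 2 2 2 2 = C 1 1 2 2 + 2 * C 1 2 1 2"
    using e3'[of 1 1 1 1, unfolded rows] e3'[of 2 2 2 2, unfolded rows] e3'[of 1 2 1 2, unfolded rows]
      e3'[of 1 1 2 2, unfolded rows]
    by (simp_all add: field_simps sqrt_3_mult)
  moreover have "C 2 2 3 3 = C 1 1 3 3"
    using e3'[of 1 1 3 3, unfolded rows] by (simp add: field_simps sqrt_3_mult)
  moreover have "C 2 3 2 3 = C 1 3 1 3"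
    using e3'[of 1 3 1 3, unfolded rows] by (simp add: field_simps sqrt_3_mult)
  moreover have "C 1 3 3 3 = 0"
    using e3'[of 1 3 3 3, unfolded rows] by (simp add: field_simps sqrt_3_mult)
  moreover have "C 1 3 2 2 = - C 1 1 1 3" "C 1 2 2 3 = - C 1 1 1 3"
    using e3'[of 1 1 1 3, unfolded rows] e3'[of 1 3 2 2, unfolded rows] e3'[of 1 2 2 3, unfolded rows]
    by (simp_all add: field_simps sqrt_3_mult)
  ultimately show ?thesis
    by (simp only: fun_eq_iff forall_3) (simp add: trigonal_C_simps)
qed

lemma planar_delta_commute: "planar_delta i j = planar_delta j i"
  by (auto simp: planar_delta_def)

lemma triangle_commute: "triangle i j k = triangle j i k"
  by (auto simp: triangle_def)

text \<open>These are the test materials: with \<open>A\<close> zero they isolate the classical part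
  of the equilibrium equations.\<close>

lemma trigonal_C_in_class:
  "(trigonal_C a b c d e f, (\<lambda>_ _ _ _ _. 0), (\<lambda>_ _ _ _ _ _. 0)) \<in> trigonal_class_Z3_Z2c"
proof -
  have "trigonal_C a b c d e f i j l m = trigonal_C a b c d e f j i l m"
    "trigonal_C a b c d e f i j l m = trigonal_C a b c d e f l m i j" for i j l m
    by (simp_all add: trigonal_C_def planar_delta_commute[of j i] planar_delta_commute[of l i]
        planar_delta_commute[of m i] planar_delta_commute[of l j] planar_delta_commute[of m j]
        triangle_commute[of j i] triangle_commute[of m l] ac_simps)
  then show ?thesis
    using rotate4_e2_trigonal_C rotate4_e3_trigonal_C
    by (simp add: trigonal_class_Z3_Z2c_def strain_gradient_materials_def
        invariant4_plus_Z2c_D3_iff invariant6_def)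
qed

section \<open>Equilibrium equations\<close>

definition second_deriv :: "(real^3 \<Rightarrow> real^3) \<Rightarrow> 3 \<Rightarrow> 3 \<Rightarrow> 3 \<Rightarrow> real^3 \<Rightarrow> real" where
  "second_deriv u l m n = partial_deriv n (partial_deriv m (\<lambda>y. u y $ l))"

lemma smooth_on_second_deriv:
  "displacement_field \<Omega> u \<Longrightarrow> smooth_on \<Omega> (second_deriv u l m n)"
  by (simp add: displacement_field_def second_deriv_def smooth_on_partial_deriv)

lemma second_deriv_commute:
  assumes "displacement_field \<Omega> u" "open \<Omega>" "x \<in> \<Omega>"
  shows "second_deriv u l m n x = second_deriv u l n m x"
  using assms partial_deriv_commute[OF assms(2) _ assms(3)]
  by (simp add: second_deriv_def displacement_field_def)

lemma strain_lincomb: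
  "strain u l m = (\<lambda>x. 1/2 * partial_deriv m (\<lambda>y. u y $ l) x + 1/2 * partial_deriv l (\<lambda>y. u y $ m) x)"
  by (simp add: fun_eq_iff strain_def field_simps)

lemma smooth_on_strain:
  "displacement_field \<Omega> u \<Longrightarrow> open \<Omega> \<Longrightarrow> smooth_on \<Omega> (strain u l m)"
  unfolding strain_lincomb
  by (intro smooth_on_lincomb smooth_on_partial_deriv) (simp_all add: displacement_field_def)

lemma partial_deriv_strain:
  assumes "displacement_field \<Omega> u" "open \<Omega>" "x \<in> \<Omega>"
  shows "partial_deriv n (strain u l m) x = (second_deriv u l m n x + second_deriv u m l n x) / 2"
proof -
  have diff: "partial_deriv b (\<lambda>y. u y $ a) differentiable at x" for a b
    using assms by (intro smooth_on_imp_differentiable[OF _ assms(2,3)] smooth_on_partial_deriv)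
      (simp add: displacement_field_def)
  show ?thesis
    unfolding strain_lincomb using diff
    by (simp add: partial_deriv_add partial_deriv_divide differentiable_divide_const
        second_deriv_def add_divide_distrib)
qed

lemma stress_divergence:
  assumes "displacement_field \<Omega> u" "open \<Omega>" "x \<in> \<Omega>"
  shows "(\<Sum>j\<in>UNIV. partial_deriv j (stress (C, (\<lambda>_ _ _ _ _. 0), A) u i j) x) =
    (\<Sum>j\<in>UNIV. \<Sum>l\<in>UNIV. \<Sum>m\<in>UNIV. C i j l m * ((second_deriv u l m j x + second_deriv u m l j x) / 2))"
proof (rule sum.cong)
  fix j
  have diff: "strain u l m differentiable at x" for l m
    using assms by (intro smooth_on_imp_differentiable[OF _ assms(2,3)] smooth_on_strain)
  have "stress (C, (\<lambda>_ _ _ _ _. 0), A) u i j =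
      (\<lambda>x. \<Sum>l\<in>UNIV. \<Sum>m\<in>UNIV. C i j l m * strain u l m x)"
    by (simp add: stress_def)
  then have "partial_deriv j (stress (C, (\<lambda>_ _ _ _ _. 0), A) u i j) x =
      (\<Sum>l\<in>UNIV. \<Sum>m\<in>UNIV. partial_deriv j (\<lambda>x. C i j l m * strain u l m x) x)"
    by (simp add: partial_deriv_sum differentiable_sum differentiable_mult diff)
  also have "\<dots> = (\<Sum>l\<in>UNIV. \<Sum>m\<in>UNIV. C i j l m *
      ((second_deriv u l m j x + second_deriv u m l j x) / 2))"
    by (simp add: partial_deriv_cmult diff partial_deriv_strain[OF assms])
  finally show "partial_deriv j (stress (C, (\<lambda>_ _ _ _ _. 0), A) u i j) x =
    (\<Sum>l\<in>UNIV. \<Sum>m\<in>UNIV. C i j l m * ((second_deriv u l m j x + second_deriv u m l j x) / 2))" .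
qed simp

text \<open>Here \<open>H\<close> abstracts the second gradient of a displacement at one point.
  Sorting the contraction by the six constants serves both directions: comparing coefficients, and
  checking that the explicit fields are in equilibrium.\<close>

lemma trigonal_C_contraction:
  fixes H :: "3 \<Rightarrow> 3 \<Rightarrow> 3 \<Rightarrow> real" and c12 c66 c13 c33 c44 c15 :: real
  assumes "\<And>l m n. H l m n = H l n m"
  defines "D \<equiv> (\<lambda>i. \<Sum>j\<in>UNIV. \<Sum>l\<in>UNIV. \<Sum>m\<in>UNIV.
      trigonal_C c12 c66 c13 c33 c44 c15 i j l m * ((H l m j + H m l j) / 2))"
  shows
    "D 1 = c12 * (H 1 1 1 + H 2 1 2) + c66 * (2 * H 1 1 1 + H 1 2 2 + H 2 1 2) + c13 * H 3 1 3
      + c44 * (H 1 3 3 + H 3 1 3) + c15 * (2 * H 1 1 3 - 2 * H 2 2 3 + H 3 1 1 - H 3 2 2)"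
    "D 2 = c12 * (H 1 1 2 + H 2 2 2) + c66 * (2 * H 2 2 2 + H 2 1 1 + H 1 1 2) + c13 * H 3 2 3
      + c44 * (H 2 3 3 + H 3 2 3) - 2 * c15 * (H 2 1 3 + H 3 1 2 + H 1 2 3)"
    "D 3 = c13 * (H 1 1 3 + H 2 2 3) + c33 * H 3 3 3
      + c44 * (H 3 1 1 + H 3 2 2 + H 1 1 3 + H 2 2 3) + c15 * (H 1 1 1 - H 1 2 2 - 2 * H 2 1 2)"
proof -
  have sym: "H l 2 1 = H l 1 2" "H l 3 1 = H l 1 3" "H l 3 2 = H l 2 3" for l
    by (rule assms(1))+
  show
    "D 1 = c12 * (H 1 1 1 + H 2 1 2) + c66 * (2 * H 1 1 1 + H 1 2 2 + H 2 1 2) + c13 * H 3 1 3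
      + c44 * (H 1 3 3 + H 3 1 3) + c15 * (2 * H 1 1 3 - 2 * H 2 2 3 + H 3 1 1 - H 3 2 2)"
    "D 2 = c12 * (H 1 1 2 + H 2 2 2) + c66 * (2 * H 2 2 2 + H 2 1 1 + H 1 1 2) + c13 * H 3 2 3
      + c44 * (H 2 3 3 + H 3 2 3) - 2 * c15 * (H 2 1 3 + H 3 1 2 + H 1 2 3)"
    "D 3 = c13 * (H 1 1 3 + H 2 2 3) + c33 * H 3 3 3
      + c44 * (H 3 1 1 + H 3 2 2 + H 1 1 3 + H 2 2 3) + c15 * (H 1 1 1 - H 1 2 2 - 2 * H 2 1 2)"
    unfolding D_def sum_3 trigonal_C_simps
    by (simp_all add: sym) (simp_all add: field_simps)
qed

lemma universal_imp_second_derivs: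
  assumes "displacement_field \<Omega> u" "open \<Omega>" "x \<in> \<Omega>"
    and univ: "universal_displacement trigonal_class_Z3_Z2c \<Omega> u"
  defines "H \<equiv> (\<lambda>l m n. second_deriv u l m n x)"
  shows "H 1 1 1 = 0" "H 1 2 2 = 0" "H 1 3 3 = 0" "H 2 1 1 = H 1 1 2" "H 2 1 2 = 0"
    "H 2 2 2 = - H 1 1 2" "H 2 2 3 = - H 1 1 3" "H 2 3 3 = 0" "H 3 1 1 = - 2 * H 1 1 3"
    "H 3 1 2 = - (H 1 2 3 + H 2 1 3)" "H 3 1 3 = 0" "H 3 2 2 = 2 * H 1 1 3" "H 3 2 3 = 0"
    "H 3 3 3 = 0"
proof -
  have H_sym: "H l m n = H l n m" for l m n
    unfolding H_def by (rule second_deriv_commute[OF assms(1-3)])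
  have "(\<Sum>j\<in>UNIV. \<Sum>l\<in>UNIV. \<Sum>m\<in>UNIV.
      trigonal_C a b c d e f i j l m * ((H l m j + H m l j) / 2)) = 0" for a b c d e f i
  proof -
    have "equilibrium \<Omega> (trigonal_C a b c d e f, \<lambda>_ _ _ _ _. 0, \<lambda>_ _ _ _ _ _. 0) u"
      using univ trigonal_C_in_class by (simp add: universal_displacement_def)
    \<comment> \<open>With \<open>M\<close> and \<open>A\<close> both zero only the divergence of
      the classical stress is left.\<close>
    moreover have "hyper_stress (trigonal_C a b c d e f, \<lambda>_ _ _ _ _. 0, \<lambda>_ _ _ _ _ _. 0) u i j k
        = (\<lambda>_. 0)" for j k
      by (simp add: hyper_stress_def)
    ultimately have "(\<Sum>j\<in>UNIV. partial_deriv j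
        (stress (trigonal_C a b c d e f, \<lambda>_ _ _ _ _. 0, \<lambda>_ _ _ _ _ _. 0) u i j) x) = 0"
      using assms(3) by (simp add: equilibrium_def)
    then show ?thesis
      unfolding stress_divergence[OF assms(1-3)] H_def .
  qed
  \<comment> \<open>One constant is set to 1 and the others to 0, for each direction in which that
    constant occurs: 14 equations in all.\<close>
  note units = this[of 1 0 0 0 0 0 1] this[of 1 0 0 0 0 0 2] this[of 0 1 0 0 0 0 1] this[of 0 1 0 0 0 0 2]
    this[of 0 0 1 0 0 0 1] this[of 0 0 1 0 0 0 2] this[of 0 0 1 0 0 0 3] this[of 0 0 0 1 0 0 3]
    this[of 0 0 0 0 1 0 1] this[of 0 0 0 0 1 0 2] this[of 0 0 0 0 1 0 3]
    this[of 0 0 0 0 0 1 1] this[of 0 0 0 0 0 1 2] this[of 0 0 0 0 0 1 3]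
  show "H 1 1 1 = 0" "H 1 2 2 = 0" "H 1 3 3 = 0" "H 2 1 1 = H 1 1 2" "H 2 1 2 = 0"
    "H 2 2 2 = - H 1 1 2" "H 2 2 3 = - H 1 1 3" "H 2 3 3 = 0" "H 3 1 1 = - 2 * H 1 1 3"
    "H 3 1 2 = - (H 1 2 3 + H 2 1 3)" "H 3 1 3 = 0" "H 3 2 2 = 2 * H 1 1 3" "H 3 2 3 = 0"
    "H 3 3 3 = 0"
    \<comment> \<open>The system is coupled: for instance, \<open>H 1 1 1 = 0\<close> needs the
      \<open>c12\<close> and \<open>c66\<close> equations in direction 1 together with the
      \<open>c15\<close> equation in direction 3.\<close>
    using units unfolding trigonal_C_contraction[of H, OF H_sym] by simp_all
qed

lemma hyper_stress_affine:
  assumes "displacement_field \<Omega> u" "open \<Omega>"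
    and "\<And>l m n. affine_fun_on \<Omega> (second_deriv u l m n)"
  shows "affine_fun_on \<Omega> (hyper_stress (C, (\<lambda>_ _ _ _ _. 0), A) u i j k)"
proof -
  have "affine_fun_on \<Omega> (partial_deriv n (strain u l m))" for l m n
  proof (rule affine_fun_on_cong)
    show "affine_fun_on \<Omega> (\<lambda>x. 1/2 * second_deriv u l m n x + 1/2 * second_deriv u m l n x)"
      using assms(3) by (intro affine_fun_on_add affine_fun_on_cmult)
    show "1/2 * second_deriv u l m n x + 1/2 * second_deriv u m l n x = partial_deriv n (strain u l m) x"
      if "x \<in> \<Omega>" for x
      by (simp add: partial_deriv_strain[OF assms(1,2) that] add_divide_distrib)
  qed
  then have "affine_fun_on \<Omega> (\<lambda>x. \<Sum>l\<in>UNIV. \<Sum>m\<in>UNIV. \<Sum>n\<in>UNIV. A i j k l m n * partial_deriv n (strain u l m) x)"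
    by (intro affine_fun_on_sum affine_fun_on_cmult)
  then show ?thesis
    by (simp add: hyper_stress_def)
qed

text \<open>Affine second derivatives make the hyper-stress affine, so its second derivatives vanish
  for every \<open>A\<close>. What remains involves \<open>C\<close> alone, and the normal form
  covers every \<open>C\<close> of the class.\<close>

lemma universal_displacementI:
  assumes u: "displacement_field \<Omega> u" "open \<Omega>"
    and affine: "\<And>l m n. affine_fun_on \<Omega> (second_deriv u l m n)"
    and "\<And>a b c d e f i x. x \<in> \<Omega> \<Longrightarrow> (\<Sum>j\<in>UNIV. \<Sum>l\<in>UNIV. \<Sum>m\<in>UNIV.
      trigonal_C a b c d e f i j l m * ((second_deriv u l m j x + second_deriv u m l j x) / 2)) = 0"
  shows "universal_displacement trigonal_class_Z3_Z2c \<Omega> u"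
  unfolding universal_displacement_def
proof
  fix \<mu> assume "\<mu> \<in> trigonal_class_Z3_Z2c"
  then obtain C A where \<mu>: "\<mu> = (C, (\<lambda>_ _ _ _ _. 0), A)"
    and C: "\<And>i j l m. C i j l m = C j i l m" "\<And>i j l m. C i j l m = C l m i j"
      "invariant4 (plus_Z2c D3) C"
    by (auto simp: trigonal_class_Z3_Z2c_def strain_gradient_materials_def)
  have "rotate4 (rotation_e2 pi) C = C" "rotate4 (rotation_e3 (2 * pi / 3)) C = C"
    using C(3) by (simp_all only: invariant4_plus_Z2c_D3_iff)
  from trigonal_C_representation[OF C(1,2) this]
  obtain a b c d e f where C_eq: "C = trigonal_C a b c d e f" ..
  show "equilibrium \<Omega> \<mu> u"
    unfolding equilibrium_def
  proof (intro ballI allI)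
    fix x i assume x: "x \<in> \<Omega>"
    show "(\<Sum>j\<in>UNIV. partial_deriv j (stress \<mu> u i j) x) -
        (\<Sum>j\<in>UNIV. \<Sum>k\<in>UNIV. partial_deriv k (partial_deriv j (hyper_stress \<mu> u i j k)) x) = 0"
      unfolding \<mu> stress_divergence[OF u x]
        affine_fun_on_imp_second_partials_zero[OF u(2) hyper_stress_affine[OF u affine] x]
      using assms(4)[OF x] by (simp add: C_eq)
  qed
qed

section \<open>Universal displacements\<close>

definition inhomogeneous_field ::
  "real \<Rightarrow> real \<Rightarrow> real \<Rightarrow> real \<Rightarrow> real \<Rightarrow> real^3 \<Rightarrow> real^3" where
  "inhomogeneous_field a123 a12 a13 a23 b13 x = vector [
     a123 * x$1 * x$2 * x$3 + a12 * x$1 * x$2 + a13 * x$1 * x$3 + a23 * x$2 * x$3,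
     1/2 * (a12 + a123 * x$3) * ((x$1)\<^sup>2 - (x$2)\<^sup>2) + b13 * x$1 * x$3 - a13 * x$2 * x$3,
     - a123 * (x$1)\<^sup>2 * x$2 - (a23 + b13) * x$1 * x$2 + 1/3 * a123 * (x$2)^3
       - a13 * ((x$1)\<^sup>2 - (x$2)\<^sup>2)]"

lemma partial_deriv_inhomogeneous_field:
  fixes a123 a12 a13 a23 b13 :: real
  defines "w \<equiv> inhomogeneous_field a123 a12 a13 a23 b13"
  shows
    "partial_deriv 1 (\<lambda>x. w x $ 1) = (\<lambda>x. a123 * x$2 * x$3 + a12 * x$2 + a13 * x$3)"
    "partial_deriv 2 (\<lambda>x. w x $ 1) = (\<lambda>x. a123 * x$1 * x$3 + a12 * x$1 + a23 * x$3)"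
    "partial_deriv 3 (\<lambda>x. w x $ 1) = (\<lambda>x. a123 * x$1 * x$2 + a13 * x$1 + a23 * x$2)"
    "partial_deriv 1 (\<lambda>x. w x $ 2) = (\<lambda>x. a12 * x$1 + a123 * x$1 * x$3 + b13 * x$3)"
    "partial_deriv 2 (\<lambda>x. w x $ 2) = (\<lambda>x. - a12 * x$2 - a123 * x$2 * x$3 - a13 * x$3)"
    "partial_deriv 3 (\<lambda>x. w x $ 2) = (\<lambda>x. a123 * ((x$1)\<^sup>2 - (x$2)\<^sup>2) / 2 + b13 * x$1 - a13 * x$2)"
    "partial_deriv 1 (\<lambda>x. w x $ 3) = (\<lambda>x. - 2 * a123 * x$1 * x$2 - (a23 + b13) * x$2 - 2 * a13 * x$1)"
    "partial_deriv 2 (\<lambda>x. w x $ 3) = (\<lambda>x. a123 * ((x$2)\<^sup>2 - (x$1)\<^sup>2) - (a23 + b13) * x$1 + 2 * a13 * x$2)"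
    "partial_deriv 3 (\<lambda>x. w x $ 3) = (\<lambda>x. 0)"
  unfolding w_def inhomogeneous_field_def vector_3 power2_eq_square power3_eq_cube
  by (simp_all add: fun_eq_iff partial_deriv_polynomial axis_def) (simp_all add: algebra_simps)

text \<open>Each right side is a constant, or a constant plus a multiple of one coordinate; signs
  such as \<open>- a12 + - a123 * x$3\<close> keep that shape, so the rules for smooth and affine
  functions match syntactically.\<close>

lemma second_partial_deriv_inhomogeneous_field:
  fixes a123 a12 a13 a23 b13 :: real
  defines "D \<equiv> (\<lambda>l m n. partial_deriv n (partial_deriv m (\<lambda>x. inhomogeneous_field a123 a12 a13 a23 b13 x $ l)))"
  shows
    "D 1 1 1 = (\<lambda>x. 0)" "D 1 1 2 = (\<lambda>x. a12 + a123 * x$3)" "D 1 1 3 = (\<lambda>x. a13 + a123 * x$2)"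
    "D 1 2 1 = (\<lambda>x. a12 + a123 * x$3)" "D 1 2 2 = (\<lambda>x. 0)" "D 1 2 3 = (\<lambda>x. a23 + a123 * x$1)"
    "D 1 3 1 = (\<lambda>x. a13 + a123 * x$2)" "D 1 3 2 = (\<lambda>x. a23 + a123 * x$1)" "D 1 3 3 = (\<lambda>x. 0)"
    "D 2 1 1 = (\<lambda>x. a12 + a123 * x$3)" "D 2 1 2 = (\<lambda>x. 0)" "D 2 1 3 = (\<lambda>x. b13 + a123 * x$1)"
    "D 2 2 1 = (\<lambda>x. 0)" "D 2 2 2 = (\<lambda>x. - a12 + - a123 * x$3)" "D 2 2 3 = (\<lambda>x. - a13 + - a123 * x$2)"
    "D 2 3 1 = (\<lambda>x. b13 + a123 * x$1)" "D 2 3 2 = (\<lambda>x. - a13 + - a123 * x$2)" "D 2 3 3 = (\<lambda>x. 0)"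
    "D 3 1 1 = (\<lambda>x. - 2 * a13 + - 2 * a123 * x$2)"
    "D 3 1 2 = (\<lambda>x. - (a23 + b13) + - 2 * a123 * x$1)" "D 3 1 3 = (\<lambda>x. 0)"
    "D 3 2 1 = (\<lambda>x. - (a23 + b13) + - 2 * a123 * x$1)"
    "D 3 2 2 = (\<lambda>x. 2 * a13 + 2 * a123 * x$2)" "D 3 2 3 = (\<lambda>x. 0)"
    "D 3 3 1 = (\<lambda>x. 0)" "D 3 3 2 = (\<lambda>x. 0)" "D 3 3 3 = (\<lambda>x. 0)"
  unfolding D_def partial_deriv_inhomogeneous_field power2_eq_square
  by (simp_all add: fun_eq_iff partial_deriv_polynomial axis_def)

lemma smooth_on_affine_component: "open \<Omega> \<Longrightarrow> smooth_on \<Omega> (\<lambda>x. a + b * x $ k)"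
proof (rule smooth_onI)
  fix m
  have "partial_deriv m (\<lambda>x. a + b * x $ k) = (\<lambda>_. b * axis m 1 $ k)"
    by (simp add: fun_eq_iff partial_deriv_polynomial)
  then show "smooth_on \<Omega> (partial_deriv m (\<lambda>x. a + b * x $ k))"
    by (simp add: smooth_on_const)
qed (simp_all add: component_differentiable)

text \<open>Two rounds of \<open>smooth_onI\<close> reduce smoothness to the tabulated second
  derivatives.\<close>

lemma displacement_field_inhomogeneous_field:
  assumes "open \<Omega>"
  shows "displacement_field \<Omega> (inhomogeneous_field a123 a12 a13 a23 b13)"
  unfolding displacement_field_def
proof (rule allI, rule smooth_onI[OF assms _ smooth_onI[OF assms]])
  let ?w = "inhomogeneous_field a123 a12 a13 a23 b13"
  fix l m n x
  have "\<forall>l. (\<lambda>x. ?w x $ l) differentiable at x"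
    unfolding forall_3 inhomogeneous_field_def vector_3
    by (simp add: component_differentiable differentiable_divide_const)
  then show "(\<lambda>x. ?w x $ l) differentiable at x" by blast
  have "\<forall>l m. partial_deriv m (\<lambda>x. ?w x $ l) differentiable at x"
    unfolding forall_3 partial_deriv_inhomogeneous_field
    by (simp add: component_differentiable differentiable_divide_const)
  then show "partial_deriv m (\<lambda>x. ?w x $ l) differentiable at x" by blast
  have "\<forall>l m n. smooth_on \<Omega> (partial_deriv n (partial_deriv m (\<lambda>x. ?w x $ l)))"
    unfolding forall_3 second_partial_deriv_inhomogeneous_field
    by (intro conjI smooth_on_const smooth_on_affine_component assms)
  then show "smooth_on \<Omega> (partial_deriv n (partial_deriv m (\<lambda>x. ?w x $ l)))" by blast
qed

section \<open>Integration of the pointwise relations\<close>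

lemma third_derivs_commute:
  assumes "displacement_field \<Omega> u" "open \<Omega>" "x \<in> \<Omega>"
  shows "partial_deriv k (second_deriv u l m n) x = partial_deriv n (second_deriv u l m k) x"
    "partial_deriv k (second_deriv u l m n) x = partial_deriv k (second_deriv u l n m) x"
proof -
  show "partial_deriv k (second_deriv u l m n) x = partial_deriv n (second_deriv u l m k) x"
    unfolding second_deriv_def using assms
    by (intro partial_deriv_commute[OF assms(2) _ assms(3)] smooth_on_partial_deriv)
      (simp add: displacement_field_def)
  show "partial_deriv k (second_deriv u l m n) x = partial_deriv k (second_deriv u l n m) x"
    using second_deriv_commute[OF assms(1,2)] by (rule partial_deriv_cong[OF assms(2,3)])
qed

lemma universal_imp_coefficients:
  assumes u: "displacement_field \<Omega> u" and \<Omega>: "convex \<Omega>" "open \<Omega>"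
    and univ: "universal_displacement trigonal_class_Z3_Z2c \<Omega> u"
  shows "\<exists>a123 a12 a13 a23 b13. \<forall>x\<in>\<Omega>.
    second_deriv u 1 1 2 x = a12 + a123 * x$3 \<and> second_deriv u 1 1 3 x = a13 + a123 * x$2 \<and>
    second_deriv u 1 2 3 x = a23 + a123 * x$1 \<and> second_deriv u 2 1 3 x = b13 + a123 * x$1"
proof -
  let ?H = "second_deriv u"
  note rel = universal_imp_second_derivs[OF u \<Omega>(2) _ univ]
  \<comment> \<open>The two rules are adjacent transpositions of the three derivatives, so together
    they generate all reorderings.\<close>
  note comm = third_derivs_commute[OF u \<Omega>(2)]
  have zero: "partial_deriv k f x = 0" if "x \<in> \<Omega>" "\<And>y. y \<in> \<Omega> \<Longrightarrow> f y = 0" for f k x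
    using partial_deriv_cong[OF \<Omega>(2) that(1), of f "\<lambda>_. 0"] that(2) by simp
  \<comment> \<open>This is \<open>u\<^sub>1\<^sub>,\<^sub>1\<^sub>2\<^sub>3\<close>, the future
    constant \<open>a123\<close>. Below, each third derivative is reordered until it either
    differentiates a vanishing second derivative or becomes \<open>T\<close>.\<close>
  define T where "T = partial_deriv 3 (?H 1 1 2)"
  have Y: "partial_deriv 1 (?H 1 1 2) x = 0" "partial_deriv 2 (?H 1 1 2) x = 0" if "x \<in> \<Omega>" for x
    using comm[OF that, of 1 1 1 2] comm[OF that, of 2 1 1 2] comm[OF that, of 2 1 2 1]
      zero[OF that rel(1)] zero[OF that rel(2)] by auto
  have P: "partial_deriv 1 (?H 1 1 3) x = 0" "partial_deriv 2 (?H 1 1 3) x = T x"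
    "partial_deriv 3 (?H 1 1 3) x = 0" if "x \<in> \<Omega>" for x
    using comm[OF that, of 1 1 1 3] comm[OF that, of 2 1 1 3] comm[OF that, of 3 1 1 3]
      comm[OF that, of 3 1 3 1] zero[OF that rel(1)] zero[OF that rel(3)] by (auto simp: T_def)
  have R: "partial_deriv 1 (?H 1 2 3) x = T x" "partial_deriv 2 (?H 1 2 3) x = 0"
    "partial_deriv 3 (?H 1 2 3) x = 0" if "x \<in> \<Omega>" for x
    using comm[OF that, of 1 1 2 3] comm[OF that, of 3 1 2 1] comm[OF that, of 2 1 2 3]
      comm[OF that, of 3 1 2 3] comm[OF that, of 3 1 3 2]
      zero[OF that rel(2)] zero[OF that rel(3)] by (auto simp: T_def)
  \<comment> \<open>The relation \<open>?H 2 1 1 = ?H 1 1 2\<close>, differentiated along the third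
    axis, carries \<open>T\<close> over to the second displacement component.\<close>
  have S: "partial_deriv 1 (?H 2 1 3) x = T x" "partial_deriv 2 (?H 2 1 3) x = 0"
    "partial_deriv 3 (?H 2 1 3) x = 0" if "x \<in> \<Omega>" for x
    using comm[OF that, of 1 2 1 3] comm[OF that, of 2 2 1 3] comm[OF that, of 3 2 1 3]
      comm[OF that, of 3 2 3 1] zero[OF that rel(5)] zero[OF that rel(8)]
      partial_deriv_cong[OF \<Omega>(2) that rel(4), where k = 3] by (auto simp: T_def)
  have smooth_T: "smooth_on \<Omega> T"
    unfolding T_def by (intro smooth_on_partial_deriv smooth_on_second_deriv u)
  have swap: "partial_deriv a (partial_deriv b (?H l m n)) x = partial_deriv b (partial_deriv a (?H l m n)) x"
    if "x \<in> \<Omega>" for a b l m n x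
    by (rule partial_deriv_commute[OF \<Omega>(2) smooth_on_second_deriv[OF u] that])
  have "partial_deriv k T x = 0" if x: "x \<in> \<Omega>" for k x
  proof -
    have "partial_deriv 1 T x = 0" "partial_deriv 2 T x = 0"
      unfolding T_def swap[OF x, of _ 3] using zero[OF x Y(1)] zero[OF x Y(2)] by auto
    \<comment> \<open>For the third direction \<open>T\<close> is rewritten as the derivative of
      \<open>?H 1 1 3\<close> along the second axis, because \<open>?H 1 1 3\<close> does not change
      along the third.\<close>
    moreover have "partial_deriv 3 T x = partial_deriv 3 (partial_deriv 2 (?H 1 1 3)) x"
      by (rule partial_deriv_cong[OF \<Omega>(2) x]) (simp add: P)
    then have "partial_deriv 3 T x = 0"
      using swap[OF x, of 3 2] zero[OF x P(3)] by simp
    ultimately show ?thesis using exhaust_3[of k] by auto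
  qed
  then obtain a123 where T: "\<And>x. x \<in> \<Omega> \<Longrightarrow> T x = a123"
    using partial_deriv_zero_imp_constant[OF \<Omega> smooth_on_imp_differentiable[OF smooth_T \<Omega>(2)]]
    by metis
  have integrate: "\<exists>c. \<forall>x\<in>\<Omega>. ?H l m n x = c + a123 * x $ p"
    if "\<forall>k. \<forall>x\<in>\<Omega>. partial_deriv k (?H l m n) x = (a123 *\<^sub>R axis p 1) $ k" for l m n p
    using constant_gradient_imp_affine[OF \<Omega>
        smooth_on_imp_differentiable[OF smooth_on_second_deriv[OF u] \<Omega>(2)], of l m n "a123 *\<^sub>R axis p 1"] that
    by (simp add: inner_axis')
  have "\<exists>c. \<forall>x\<in>\<Omega>. ?H 1 1 2 x = c + a123 * x $ 3"
    using Y T by (intro integrate) (simp add: forall_3 axis_def T_def)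
  moreover have "\<exists>c. \<forall>x\<in>\<Omega>. ?H 1 1 3 x = c + a123 * x $ 2"
    using P T by (intro integrate) (simp add: forall_3 axis_def)
  moreover have "\<exists>c. \<forall>x\<in>\<Omega>. ?H 1 2 3 x = c + a123 * x $ 1"
    using R T by (intro integrate) (simp add: forall_3 axis_def)
  moreover have "\<exists>c. \<forall>x\<in>\<Omega>. ?H 2 1 3 x = c + a123 * x $ 1"
    using S T by (intro integrate) (simp add: forall_3 axis_def)
  ultimately show ?thesis
    by metis
qed

text \<open>Translates superposition with a homogeneous field into agreement of second derivatives,
  the form in which universality is characterized.\<close>

lemma second_deriv_eq_iff_affine_difference:
  assumes "displacement_field \<Omega> u" "displacement_field \<Omega> w" "convex \<Omega>" "open \<Omega>"
  shows "(\<forall>x\<in>\<Omega>. \<forall>l m n. second_deriv u l m n x = second_deriv w l m n x) \<longleftrightarrow>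
    homogeneous \<Omega> (\<lambda>x. u x - w x)"
proof -
  have *: "smooth_on \<Omega> (\<lambda>x. u x $ l - w x $ l)" for l
    using assms by (simp add: displacement_field_def smooth_on_diff)
  have diff: "partial_deriv n (partial_deriv m (\<lambda>y. u y $ l - w y $ l)) x =
      second_deriv u l m n x - second_deriv w l m n x" if "x \<in> \<Omega>" for l m n x
    using assms that by (simp add: second_deriv_def displacement_field_def second_partial_deriv_diff)
  show ?thesis
  proof
    assume "\<forall>x\<in>\<Omega>. \<forall>l m n. second_deriv u l m n x = second_deriv w l m n x"
    then have "affine_fun_on \<Omega> (\<lambda>x. u x $ l - w x $ l)" for l
      by (intro second_partials_zero_imp_affine[OF assms(3,4) *]) (simp add: diff)
    then show "homogeneous \<Omega> (\<lambda>x. u x - w x)"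
      by (simp add: homogeneous_iff)
  next
    assume "homogeneous \<Omega> (\<lambda>x. u x - w x)"
    then have affine: "affine_fun_on \<Omega> (\<lambda>x. u x $ l - w x $ l)" for l
      by (simp add: homogeneous_iff)
    show "\<forall>x\<in>\<Omega>. \<forall>l m n. second_deriv u l m n x = second_deriv w l m n x"
    proof (intro ballI allI)
      fix x l m n assume "x \<in> \<Omega>"
      with diff affine_fun_on_imp_second_partials_zero[OF assms(4) affine]
      show "second_deriv u l m n x = second_deriv w l m n x" by force
    qed
  qed
qed

lemma universal_iff_second_derivs:
  assumes u: "displacement_field \<Omega> u" and \<Omega>: "convex \<Omega>" "open \<Omega>"
  shows "universal_displacement trigonal_class_Z3_Z2c \<Omega> u \<longleftrightarrow>
    (\<exists>a123 a12 a13 a23 b13. \<forall>x\<in>\<Omega>. \<forall>l m n. second_deriv u l m n x =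
      second_deriv (inhomogeneous_field a123 a12 a13 a23 b13) l m n x)"
    (is "_ \<longleftrightarrow> ?R")
proof
  assume univ: "universal_displacement trigonal_class_Z3_Z2c \<Omega> u"
  then obtain a123 a12 a13 a23 b13 where *: "\<forall>x\<in>\<Omega>.
    second_deriv u 1 1 2 x = a12 + a123 * x$3 \<and> second_deriv u 1 1 3 x = a13 + a123 * x$2 \<and>
    second_deriv u 1 2 3 x = a23 + a123 * x$1 \<and> second_deriv u 2 1 3 x = b13 + a123 * x$1"
    using universal_imp_coefficients[OF u \<Omega>] by blast
  have "\<forall>l m n. second_deriv u l m n x =
      second_deriv (inhomogeneous_field a123 a12 a13 a23 b13) l m n x" if x: "x \<in> \<Omega>" for x
  proof -
    \<comment> \<open>Symmetry leaves 18 of the 27 second derivatives: 14 are fixed by the universal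
      relations and 4 by the coefficients just obtained.\<close>
    have sym: "second_deriv u l 2 1 x = second_deriv u l 1 2 x"
      "second_deriv u l 3 1 x = second_deriv u l 1 3 x"
      "second_deriv u l 3 2 x = second_deriv u l 2 3 x" for l
      by (rule second_deriv_commute[OF u \<Omega>(2) x])+
    show ?thesis
      unfolding forall_3
      using * x universal_imp_second_derivs[OF u \<Omega>(2) x univ]
      by (simp add: sym second_deriv_def[of "inhomogeneous_field _ _ _ _ _"]
          second_partial_deriv_inhomogeneous_field)
  qed
  then show ?R by blast
next
  assume ?R
  then obtain a123 a12 a13 a23 b13 where *: "\<And>x l m n. x \<in> \<Omega> \<Longrightarrow> second_deriv u l m n x =
      second_deriv (inhomogeneous_field a123 a12 a13 a23 b13) l m n x" by blast
  let ?w = "inhomogeneous_field a123 a12 a13 a23 b13"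
  have "\<forall>l m n. affine_fun_on \<Omega> (second_deriv ?w l m n)"
    unfolding forall_3 second_deriv_def second_partial_deriv_inhomogeneous_field
    by (intro conjI affine_fun_on_const affine_fun_on_add affine_fun_on_cmult affine_fun_on_component)
  then have "affine_fun_on \<Omega> (second_deriv ?w l m n)" for l m n by blast
  then have affine: "affine_fun_on \<Omega> (second_deriv u l m n)" for l m n
    by (rule affine_fun_on_cong) (simp add: *)
  show "universal_displacement trigonal_class_Z3_Z2c \<Omega> u"
  proof (rule universal_displacementI[OF u \<Omega>(2) affine])
    fix a b c d e f x and i :: 3 assume x: "x \<in> \<Omega>"
    define H where "H l m n = second_deriv u l m n x" for l m n
    have H_sym: "H l m n = H l n m" for l m n
      unfolding H_def by (rule second_deriv_commute[OF u \<Omega>(2) x])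
    have H: "H l m n = second_deriv ?w l m n x" for l m n
      unfolding H_def by (rule *[OF x])
    note H_table = H[unfolded second_deriv_def]
    \<comment> \<open>The contraction is expanded while \<open>H\<close> is still abstract;
      inserting the table then cancels the coefficient of each of the six constants.\<close>
    have "\<forall>i. (\<Sum>j\<in>UNIV. \<Sum>l\<in>UNIV. \<Sum>m\<in>UNIV.
      trigonal_C a b c d e f i j l m * ((H l m j + H m l j) / 2)) = 0"
      unfolding forall_3 trigonal_C_contraction[of H, OF H_sym]
      unfolding H_table second_partial_deriv_inhomogeneous_field
      by (simp add: algebra_simps)
    then show "(\<Sum>j\<in>UNIV. \<Sum>l\<in>UNIV. \<Sum>m\<in>UNIV.
      trigonal_C a b c d e f i j l m * ((second_deriv u l m j x + second_deriv u m l j x) / 2)) = 0"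
      unfolding H_def by (rule spec)
  qed
qed

theorem proposition3p14:
  fixes \<Omega> :: "(real^3) set" and u :: "real^3 \<Rightarrow> real^3"
  assumes "\<Omega> \<noteq> {}" and "open \<Omega>" and "convex \<Omega>"
    and "displacement_field \<Omega> u"
  shows "universal_displacement trigonal_class_Z3_Z2c \<Omega> u \<longleftrightarrow>
    (\<exists>u_hom u_inh :: real^3 \<Rightarrow> real^3.
       homogeneous \<Omega> u_hom \<and>
       (\<exists>a123 a12 a13 a23 b13 :: real. \<forall>x\<in>\<Omega>.
          u_inh x $ 1 = a123 * x$1 * x$2 * x$3 + a12 * x$1 * x$2 + a13 * x$1 * x$3 + a23 * x$2 * x$3 \<and>
          u_inh x $ 2 = 1/2 * (a12 + a123 * x$3) * ((x$1)\<^sup>2 - (x$2)\<^sup>2) + b13 * x$1 * x$3 - a13 * x$2 * x$3 \<and>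
          u_inh x $ 3 = - a123 * (x$1)\<^sup>2 * x$2 - (a23 + b13) * x$1 * x$2
                        + 1/3 * a123 * (x$2)^3 - a13 * ((x$1)\<^sup>2 - (x$2)\<^sup>2)) \<and>
       (\<forall>x\<in>\<Omega>. u x = u_hom x + u_inh x))"
proof -
  have form: "(v $ 1 = a123 * x$1 * x$2 * x$3 + a12 * x$1 * x$2 + a13 * x$1 * x$3 + a23 * x$2 * x$3 \<and>
      v $ 2 = 1/2 * (a12 + a123 * x$3) * ((x$1)\<^sup>2 - (x$2)\<^sup>2) + b13 * x$1 * x$3 - a13 * x$2 * x$3 \<and>
      v $ 3 = - a123 * (x$1)\<^sup>2 * x$2 - (a23 + b13) * x$1 * x$2
        + 1/3 * a123 * (x$2)^3 - a13 * ((x$1)\<^sup>2 - (x$2)\<^sup>2)) \<longleftrightarrow>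
      v = inhomogeneous_field a123 a12 a13 a23 b13 x" for v x :: "real^3" and a123 a12 a13 a23 b13
    by (simp only: vec_eq_iff forall_3 inhomogeneous_field_def vector_3)
  have "homogeneous \<Omega> (\<lambda>x. u x - w x) \<longleftrightarrow>
      (\<exists>u_hom u_inh. homogeneous \<Omega> u_hom \<and> (\<forall>x\<in>\<Omega>. u_inh x = w x) \<and> (\<forall>x\<in>\<Omega>. u x = u_hom x + u_inh x))"
    (is "?L \<longleftrightarrow> ?R") for w
  proof
    assume ?L
    \<comment> \<open>The homogeneous part is the difference of the two fields, the inhomogeneous
      part is \<open>w\<close> itself.\<close>
    then show ?R
      by (intro exI[of _ "\<lambda>x. u x - w x"] exI[of _ w]) simp
  next
    assume ?R
    then obtain u_hom where "homogeneous \<Omega> u_hom" "\<forall>x\<in>\<Omega>. u x - w x = u_hom x"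
      by auto
    then show ?L
      by (simp add: homogeneous_def)
  qed
  then show ?thesis
    unfolding universal_iff_second_derivs[OF assms(4,3,2)] form
      second_deriv_eq_iff_affine_difference[OF assms(4)
        displacement_field_inhomogeneous_field[OF assms(2)] assms(3,2)]
    by blast
qed

end
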